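(* Let $1<\alpha(\omega)<3$, $0<\beta(\omega)<2$, $0\le\lambda(\omega)<1$, $m_{\mathrm{eff}}>0$ and $|\zeta_{\mathrm{eff}}|\le1$. Let $H(\omega)$ be the (restricted) frequency transfer function of the variable-order fractional vibrator $m x^{(\alpha(\omega))}(t)+c x^{(\beta(\omega))}(t)+k x^{(\lambda(\omega))}(t)=f(t)$. It is given by $$H(\omega)=\frac{1}{k_{\mathrm{eff}}\left(1-\gamma_{\mathrm{eff}}^2+i2\zeta_{\mathrm{eff}}\gamma_{\mathrm{eff}}\right)}.$$
   Context: $m,c,k>0$ are constants, $\alpha,\beta,\lambda$ are real functions of frequency $\omega>0$, $i=\sqrt{-1}$. Define $$m_{\mathrm{eff}}=-\left[m\omega^{\alpha(\omega)-2}\cos\frac{\alpha(\omega)\pi}{2}+c\omega^{\beta(\omega)-2}\cos\frac{\beta(\omega)\pi}{2}\right],$$ $$c_{\mathrm{eff}}=m\omega^{\alpha(\omega)-1}\sin\frac{\alpha(\omega)\pi}{2}+c\omega^{\beta(\omega)-1}\sin\frac{\beta(\omega)\pi}{2}+k\omega^{\lambda(\omega)-1}\sin\frac{\lambda(\omega)\pi}{2},\qquad k_{\mathrm{eff}}=k\omega^{\lambda(\omega)}\cos\frac{\lambda(\omega)\pi}{2},$$ $$\zeta_{\mathrm{eff}}=\frac{c_{\mathrm{eff}}}{2\sqrt{m_{\mathrm{eff}}k_{\mathrm{eff}}}},\quad\omega_{\mathrm{effn}}=\sqrt{\frac{k_{\mathrm{eff}}}{m_{\mathrm{eff}}}},\quad\omega_{\mathrm{effd}}=\omega_{\mathrm{effn}}\sqrt{1-\zeta_{\mathrm{eff}}^2},\quad\gamma_{\mathrm{eff}}=\frac{\omega}{\omega_{\mathrm{effn}}}.$$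 The impulse response is $h(t)=h(t,\omega)=e^{-\zeta_{\mathrm{eff}}\omega_{\mathrm{effn}}t}\frac{1}{m_{\mathrm{eff}}\omega_{\mathrm{effd}}}\sin\omega_{\mathrm{effd}}t$ for $t\ge0$ and $0$ for $t<0$ (with $\frac{\sin\omega_{\mathrm{effd}}t}{\omega_{\mathrm{effd}}}$ read as $t$ when $\omega_{\mathrm{effd}}=0$). The frequency transfer function $H(\omega)$ is the Fourier transform of the impulse response, $H(\omega)=\int_0^\infty h(t,\omega)e^{-i\omega t}\,dt$, the effective parameters being evaluated at the same $\omega$.
   Formalization: The formula for H(ω) is asserted only when the defining integral ∫_0^∞ h(t,ω)e^{-iωt}dt converges, which is proved to happen exactly when ζ_eff>0; for -1≤ζ_eff≤0 the integral diverges and H(ω) is undefined. *)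

theory Defs
  imports "HOL-Analysis.Analysis"
begin

text \<open>
  The vibrator \<open>m x^(\<alpha>(\<omega>)) + c x^(\<beta>(\<omega>)) + k x^(lam(\<omega>)) = f\<close> enters through its effective
  parameters, each a function of the frequency \<open>\<omega> > 0\<close>.
\<close>

definition m_eff :: "real \<Rightarrow> real \<Rightarrow> (real \<Rightarrow> real) \<Rightarrow> (real \<Rightarrow> real) \<Rightarrow> real \<Rightarrow> real" where
  "m_eff m c \<alpha> \<beta> \<omega> =
     - (m * \<omega> powr (\<alpha> \<omega> - 2) * cos (\<alpha> \<omega> * pi / 2)
        + c * \<omega> powr (\<beta> \<omega> - 2) * cos (\<beta> \<omega> * pi / 2))"

definition c_eff ::
  "real \<Rightarrow> real \<Rightarrow> real \<Rightarrow> (real \<Rightarrow> real) \<Rightarrow> (real \<Rightarrow> real) \<Rightarrow> (real \<Rightarrow> real) \<Rightarrow> real \<Rightarrow> real" where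
  "c_eff m c k \<alpha> \<beta> lam \<omega> =
     m * \<omega> powr (\<alpha> \<omega> - 1) * sin (\<alpha> \<omega> * pi / 2)
     + c * \<omega> powr (\<beta> \<omega> - 1) * sin (\<beta> \<omega> * pi / 2)
     + k * \<omega> powr (lam \<omega> - 1) * sin (lam \<omega> * pi / 2)"

definition k_eff :: "real \<Rightarrow> (real \<Rightarrow> real) \<Rightarrow> real \<Rightarrow> real" where
  "k_eff k lam \<omega> = k * \<omega> powr (lam \<omega>) * cos (lam \<omega> * pi / 2)"

definition zeta_eff ::
  "real \<Rightarrow> real \<Rightarrow> real \<Rightarrow> (real \<Rightarrow> real) \<Rightarrow> (real \<Rightarrow> real) \<Rightarrow> (real \<Rightarrow> real) \<Rightarrow> real \<Rightarrow> real" where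
  "zeta_eff m c k \<alpha> \<beta> lam \<omega> =
     c_eff m c k \<alpha> \<beta> lam \<omega> / (2 * sqrt (m_eff m c \<alpha> \<beta> \<omega> * k_eff k lam \<omega>))"

definition omega_effn ::
  "real \<Rightarrow> real \<Rightarrow> real \<Rightarrow> (real \<Rightarrow> real) \<Rightarrow> (real \<Rightarrow> real) \<Rightarrow> (real \<Rightarrow> real) \<Rightarrow> real \<Rightarrow> real" where
  "omega_effn m c k \<alpha> \<beta> lam \<omega> = sqrt (k_eff k lam \<omega> / m_eff m c \<alpha> \<beta> \<omega>)"

definition omega_effd ::
  "real \<Rightarrow> real \<Rightarrow> real \<Rightarrow> (real \<Rightarrow> real) \<Rightarrow> (real \<Rightarrow> real) \<Rightarrow> (real \<Rightarrow> real) \<Rightarrow> real \<Rightarrow> real" where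
  "omega_effd m c k \<alpha> \<beta> lam \<omega> =
     omega_effn m c k \<alpha> \<beta> lam \<omega> * sqrt (1 - (zeta_eff m c k \<alpha> \<beta> lam \<omega>)\<^sup>2)"

definition gamma_eff ::
  "real \<Rightarrow> real \<Rightarrow> real \<Rightarrow> (real \<Rightarrow> real) \<Rightarrow> (real \<Rightarrow> real) \<Rightarrow> (real \<Rightarrow> real) \<Rightarrow> real \<Rightarrow> real" where
  "gamma_eff m c k \<alpha> \<beta> lam \<omega> = \<omega> / omega_effn m c k \<alpha> \<beta> lam \<omega>"

text \<open>At critical damping (\<open>omega_effd = 0\<close>) the quotient \<open>sin (w t) / w\<close> is read as its limit \<open>t\<close>.\<close>

definition impulse_response ::
  "real \<Rightarrow> real \<Rightarrow> real \<Rightarrow> (real \<Rightarrow> real) \<Rightarrow> (real \<Rightarrow> real) \<Rightarrow> (real \<Rightarrow> real) \<Rightarrow> real \<Rightarrow> real \<Rightarrow> real" where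
  "impulse_response m c k \<alpha> \<beta> lam \<omega> t =
     (let w = omega_effd m c k \<alpha> \<beta> lam \<omega> in
      if t < 0 then 0
      else exp (- zeta_eff m c k \<alpha> \<beta> lam \<omega> * omega_effn m c k \<alpha> \<beta> lam \<omega> * t)
           * (1 / m_eff m c \<alpha> \<beta> \<omega>) * (if w = 0 then t else sin (w * t) / w))"

definition transfer_integrand ::
  "real \<Rightarrow> real \<Rightarrow> real \<Rightarrow> (real \<Rightarrow> real) \<Rightarrow> (real \<Rightarrow> real) \<Rightarrow> (real \<Rightarrow> real) \<Rightarrow> real \<Rightarrow> real \<Rightarrow> complex" where
  "transfer_integrand m c k \<alpha> \<beta> lam \<omega> t =
     complex_of_real (impulse_response m c k \<alpha> \<beta> lam \<omega> t)
     * exp (- \<i> * complex_of_real \<omega> * complex_of_real t)"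

text \<open>
  \<open>integrable_on\<close> over the unbounded set \<open>{0..}\<close> is Henstock-Kurzweil integrability, i.e. convergence
  of the improper integral over \<open>[0, T]\<close> as \<open>T\<close> tends to infinity; absolute convergence is not
  required. Where it fails, \<open>H(\<omega>)\<close> is undefined and \<open>freq_transfer\<close> is the default value 0.
\<close>

definition transfer_converges ::
  "real \<Rightarrow> real \<Rightarrow> real \<Rightarrow> (real \<Rightarrow> real) \<Rightarrow> (real \<Rightarrow> real) \<Rightarrow> (real \<Rightarrow> real) \<Rightarrow> real \<Rightarrow> bool" where
  "transfer_converges m c k \<alpha> \<beta> lam \<omega> \<longleftrightarrow>
     transfer_integrand m c k \<alpha> \<beta> lam \<omega> integrable_on {0..}"

definition freq_transfer ::
  "real \<Rightarrow> real \<Rightarrow> real \<Rightarrow> (real \<Rightarrow> real) \<Rightarrow> (real \<Rightarrow> real) \<Rightarrow> (real \<Rightarrow> real) \<Rightarrow> real \<Rightarrow> complex" where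
  "freq_transfer m c k \<alpha> \<beta> lam \<omega> = integral {0..} (transfer_integrand m c k \<alpha> \<beta> lam \<omega>)"

end

theory Submission
  imports Defs "HOL-Real_Asymp.Real_Asymp"
begin

text \<open>
  Write \<open>M\<close>, \<open>K\<close>, \<open>z\<close>, \<open>n\<close>, \<open>d\<close> for the effective mass, stiffness, damping ratio, natural frequency
  and damped frequency. At a fixed \<open>\<omega>\<close> the vibrator is an ordinary damped oscillator with constant
  coefficients, and its transfer integral is, up to the factor \<open>1 / M\<close>, the Laplace transform of
  \<open>S t = sin (d t) / d\<close> at the complex point \<open>s = z n + \<i> \<omega>\<close>. Everything follows from two facts about
  that transform, for arbitrary complex \<open>s\<close> and real \<open>d\<close>.

  If \<open>Re s > 0\<close>, it equals \<open>1 / (s\<^sup>2 + d\<^sup>2)\<close> (\<open>laplace_oscillation\<close>). Since \<open>S'' = - d\<^sup>2 S\<close>, the integrand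
  has the explicit antiderivative \<open>- e^(- s t) (s S + S') / (s\<^sup>2 + d\<^sup>2)\<close>, which vanishes at infinity because
  the bracket grows at most linearly. The form of this antiderivative is the same for \<open>d = 0\<close>, so
  critical damping needs no separate treatment.

  If \<open>Re s \<le> 0\<close>, the integral diverges even as an improper integral (\<open>laplace_oscillation_diverges\<close>):
  there are times \<open>T\<close> tending to infinity after which \<open>S\<close> repeats, or exceeds, its behaviour after time 0,
  and the exponential does not damp it. So the integral over a short window of fixed length placed
  after \<open>T\<close> stays away from 0, against the Cauchy criterion. Rotating the integrand by a constant phase
  makes the factor \<open>e^(- \<i> Im s t)\<close> nearly 1 on that window. This argument does not distinguish resonance,
  where \<open>s\<^sup>2 + d\<^sup>2 = 0\<close>, from the other undamped cases.

  The effective stiffness is positive because \<open>0 \<le> \<lambda> < 1\<close>, so \<open>n > 0\<close> and \<open>Re s = z n\<close> has the sign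
  of \<open>z\<close>. Finally \<open>\<bar>z\<bar> \<le> 1\<close> gives \<open>d\<^sup>2 = n\<^sup>2 (1 - z\<^sup>2)\<close>, whence
  \<open>M (s\<^sup>2 + d\<^sup>2) = M (n\<^sup>2 - \<omega>\<^sup>2 + 2 \<i> z n \<omega>)\<close>, and \<open>K = M n\<^sup>2\<close> turns this into the denominator of \<open>H\<close>.
\<close>

section \<open>Improper integrals over a half-line\<close>

text \<open>
  The Henstock-Kurzweil integral has no improper integrals beyond itself: its definition on an unbounded
  set already asks for convergence over large boxes, and on a half-line only the right end of the
  box matters. Both convergence and divergence below are read off from this equivalence.
\<close>

lemma has_integral_atLeast_iff_tendsto:
  fixes f :: "real \<Rightarrow> 'a::banach"
  assumes int: "\<And>b. f integrable_on {a..b}"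
  shows "(f has_integral I) {a..} \<longleftrightarrow> ((\<lambda>b. integral {a..b} f) \<longlongrightarrow> I) at_top"
proof -
  let ?g = "\<lambda>x. if x \<in> {a..} then f x else 0"
  have g_int: "?g integrable_on cbox p q" for p q
  proof -
    have "{a..} \<inter> {p..q} = {max a p..q}"
      by auto
    moreover have "f integrable_on {max a p..q}"
      by (rule integrable_on_subinterval[OF int[of q]]) auto
    ultimately show ?thesis
      by (simp only: integrable_restrict_Int box_real)
  qed
  have g_eq: "integral (cbox p q) ?g = integral {a..q} f" if "p \<le> a" for p q
  proof -
    have "{a..} \<inter> {p..q} = {a..q}"
      using that by auto
    then show ?thesis
      by (simp only: integral_restrict_Int box_real)
  qed
  show ?thesis
  proof
    assume "(f has_integral I) {a..}"
    show "((\<lambda>b. integral {a..b} f) \<longlongrightarrow> I) at_top"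
    proof (rule tendstoI)
      fix e :: real assume "e > 0"
      with \<open>(f has_integral I) {a..}\<close> obtain B where
        B: "\<And>p q. ball 0 B \<subseteq> cbox p q \<Longrightarrow> norm (integral (cbox p q) ?g - I) < e"
        unfolding has_integral_alt' by meson
      show "\<forall>\<^sub>F b in at_top. dist (integral {a..b} f) I < e"
        using eventually_ge_at_top[of "max B \<bar>a\<bar>"]
      proof eventually_elim
        case (elim b)
        then have "ball 0 B \<subseteq> cbox (- b) b" "- b \<le> a"
          by (auto simp: dist_real_def)
        with B[of "- b" b] g_eq[of "- b" b] show ?case
          by (simp add: dist_norm)
      qed
    qed
  next
    assume lim: "((\<lambda>b. integral {a..b} f) \<longlongrightarrow> I) at_top"
    have "\<exists>B>0. \<forall>p q. ball 0 B \<subseteq> cbox p q \<longrightarrow> norm (integral (cbox p q) ?g - I) < e"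
      if "e > 0" for e :: real
    proof -
      from lim that obtain N where N: "\<And>b. b \<ge> N \<Longrightarrow> dist (integral {a..b} f) I < e"
        unfolding tendsto_iff eventually_at_top_linorder by meson
      define B where "B = \<bar>N\<bar> + \<bar>a\<bar> + 1"
      have "norm (integral (cbox p q) ?g - I) < e" if "ball 0 B \<subseteq> cbox p q" for p q
      proof -
        have "- (\<bar>N\<bar> + \<bar>a\<bar>) \<in> ball 0 B" "\<bar>N\<bar> + \<bar>a\<bar> \<in> ball 0 B"
          by (auto simp: B_def dist_real_def)
        with that have "- (\<bar>N\<bar> + \<bar>a\<bar>) \<in> cbox p q" "\<bar>N\<bar> + \<bar>a\<bar> \<in> cbox p q"
          by blast+
        then have "p \<le> a" "N \<le> q"
          by auto
        then show ?thesis
          using g_eq[of p q] N[of q] by (simp add: dist_norm)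
      qed
      moreover have "B > 0"
        by (simp add: B_def)
      ultimately show ?thesis
        by blast
    qed
    then show "(f has_integral I) {a..}"
      unfolding has_integral_alt' using g_int by blast
  qed
qed

section \<open>The undamped oscillation\<close>

text \<open>
  The solution of \<open>S'' = - w\<^sup>2 S\<close>, \<open>S 0 = 0\<close>, \<open>S' 0 = 1\<close>; its value at \<open>w = 0\<close> is the limit that
  makes this true there as well.
\<close>

definition oscillation :: "real \<Rightarrow> real \<Rightarrow> real" where
  "oscillation w t = (if w = 0 then t else sin (w * t) / w)"

lemma has_field_derivative_oscillation:
  "(oscillation w has_real_derivative cos (w * t)) (at t within A)"
  unfolding oscillation_def by (cases "w = 0") (auto intro!: derivative_eq_intros)

lemma continuous_on_oscillation: "continuous_on A (oscillation w)"
  by (meson DERIV_continuous continuous_on_eq_continuous_within has_field_derivative_oscillation)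

lemma abs_oscillation_le: "\<bar>oscillation w t\<bar> \<le> \<bar>t\<bar>"
proof (cases "w = 0")
  case False
  then show ?thesis
    using abs_sin_x_le_abs_x[of "w * t"]
    by (simp add: oscillation_def abs_mult field_simps)
qed (simp add: oscillation_def)

section \<open>Convergence of the Laplace transform\<close>

lemma laplace_denominator_nonzero:
  fixes s :: complex
  assumes "Re s > 0"
  shows "s\<^sup>2 + (of_real w)\<^sup>2 \<noteq> 0"
proof
  assume "s\<^sup>2 + (of_real w)\<^sup>2 = 0"
  then have "(Re s)\<^sup>2 - (Im s)\<^sup>2 + w\<^sup>2 = 0" "Re s * Im s = 0"
    by (auto simp: complex_eq_iff power2_eq_square)
  with assms show False
    by (simp add: sum_power2_eq_zero_iff)
qed

lemma integrable_on_laplace_oscillation: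
  "(\<lambda>t. exp (- s * of_real t) * of_real (oscillation w t)) integrable_on {a..b}"
  for s :: complex
  by (intro integrable_continuous_real continuous_intros continuous_on_oscillation)

text \<open>
  The antiderivative \<open>F\<close> is found by varying \<open>e^(- s t) (p S + q S')\<close> over constants \<open>p\<close>, \<open>q\<close>: the
  derivatives only produce \<open>S\<close> and \<open>S'\<close> again, and \<open>p = s\<close>, \<open>q = 1\<close> cancels the \<open>S'\<close> terms.
\<close>

lemma laplace_oscillation:
  fixes s :: complex
  assumes "Re s > 0"
  shows "((\<lambda>t. exp (- s * of_real t) * of_real (oscillation w t))
           has_integral 1 / (s\<^sup>2 + (of_real w)\<^sup>2)) {0..}"
proof -
  define D where "D = s\<^sup>2 + (of_real w)\<^sup>2"
  have D: "D \<noteq> 0"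
    unfolding D_def using assms by (rule laplace_denominator_nonzero)
  define F where
    "F t = - (exp (- s * of_real t) * (s * of_real (oscillation w t) + of_real (cos (w * t)))) / D" for t
  let ?f = "\<lambda>t. exp (- s * of_real t) * of_real (oscillation w t)"
  have sin_eq: "complex_of_real (sin (w * t)) = of_real w * of_real (oscillation w t)" for t
    by (simp add: oscillation_def)
  have F_deriv: "(F has_vector_derivative ?f t) (at t within A)" for t A
  proof -
    have E: "((\<lambda>t. exp (- s * of_real t)) has_vector_derivative - s * exp (- s * of_real t)) (at t within A)"
      by (rule has_vector_derivative_real_field) (auto intro!: derivative_eq_intros)
    have "((\<lambda>t. cos (w * t)) has_real_derivative - (w * sin (w * t))) (at t within A)"
      by (auto intro!: derivative_eq_intros)
    then have C: "((\<lambda>t. complex_of_real (cos (w * t)))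
        has_vector_derivative of_real (- (w * sin (w * t)))) (at t within A)"
      unfolding has_real_derivative_iff_has_vector_derivative
      by (rule bounded_linear.has_vector_derivative[OF bounded_linear_of_real])
    have S: "((\<lambda>t. complex_of_real (oscillation w t))
        has_vector_derivative of_real (cos (w * t))) (at t within A)"
      using has_field_derivative_oscillation[of w t A]
      unfolding has_real_derivative_iff_has_vector_derivative
      by (rule bounded_linear.has_vector_derivative[OF bounded_linear_of_real])
    have "(F has_vector_derivative
        - (exp (- s * of_real t) * (s * of_real (cos (w * t)) + of_real (- (w * sin (w * t))))
           + - s * exp (- s * of_real t) * (s * of_real (oscillation w t) + of_real (cos (w * t)))) / D)
        (at t within A)"
      unfolding F_def
      by (intro has_vector_derivative_divide has_vector_derivative_minus has_vector_derivative_mult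
            has_vector_derivative_add has_vector_derivative_mult_right E C S)
    also have "- (exp (- s * of_real t) * (s * of_real (cos (w * t)) + of_real (- (w * sin (w * t))))
           + - s * exp (- s * of_real t) * (s * of_real (oscillation w t) + of_real (cos (w * t)))) / D
        = exp (- s * of_real t) * (D * of_real (oscillation w t)) / D"
      unfolding of_real_minus of_real_mult sin_eq by (simp add: D_def algebra_simps power2_eq_square)
    finally show ?thesis
      using D by simp
  qed
  have int: "integral {0..T} ?f = F T - F 0" if "T \<ge> 0" for T
    by (rule integral_unique, rule fundamental_theorem_of_calculus[OF that F_deriv])
  have "(F \<longlongrightarrow> 0) at_top"
  proof (rule Lim_null_comparison)
    show "\<forall>\<^sub>F t in at_top. norm (F t) \<le> exp (- Re s * t) * (norm s * t + 1) / norm D"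
      using eventually_ge_at_top[of 0]
    proof eventually_elim
      case (elim t)
      have "norm (s * of_real (oscillation w t) + of_real (cos (w * t)))
          \<le> norm s * \<bar>oscillation w t\<bar> + \<bar>cos (w * t)\<bar>"
        by (rule norm_triangle_le) (simp add: norm_mult)
      also have "\<dots> \<le> norm s * t + 1"
        using abs_oscillation_le[of w t] elim by (intro add_mono mult_left_mono) auto
      finally show ?case
        by (simp add: F_def norm_mult norm_divide divide_right_mono)
    qed
    show "((\<lambda>t. exp (- Re s * t) * (norm s * t + 1) / norm D) \<longlongrightarrow> 0) at_top"
    proof -
      have "((\<lambda>t. exp (- Re s * t) * (norm s * t + 1)) \<longlongrightarrow> 0) at_top"
        using assms by real_asymp
      then show ?thesis
        by (rule tendsto_divide_zero)
    qed
  qed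
  then have "((\<lambda>T. F T - F 0) \<longlongrightarrow> 0 - F 0) at_top"
    by (intro tendsto_intros)
  then have "((\<lambda>T. integral {0..T} ?f) \<longlongrightarrow> 0 - F 0) at_top"
    by (rule Lim_transform_eventually)
       (rule eventually_mono[OF eventually_ge_at_top[of 0]], simp only: int)
  moreover have "0 - F 0 = 1 / D"
    by (simp add: F_def oscillation_def)
  ultimately show ?thesis
    unfolding D_def by (subst has_integral_atLeast_iff_tendsto[OF integrable_on_laplace_oscillation]) simp
qed

section \<open>Divergence of the Laplace transform\<close>

lemma oscillation_abs: "oscillation w = oscillation \<bar>w\<bar>"
  by (auto simp: oscillation_def fun_eq_iff abs_if)

lemma oscillation_mono:
  assumes "0 \<le> t" "t \<le> u" "\<bar>w\<bar> * u \<le> pi / 2"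
  shows "oscillation w t \<le> oscillation w u"
proof -
  have "\<bar>w\<bar> * t \<le> \<bar>w\<bar> * u" "0 \<le> \<bar>w\<bar> * t"
    using assms by (auto intro: mult_left_mono)
  with assms have "sin (\<bar>w\<bar> * t) \<le> sin (\<bar>w\<bar> * u)"
    using pi_gt_zero by (intro sin_monotone_2pi_le) linarith+
  with assms show ?thesis
    by (subst (1 2) oscillation_abs) (auto simp: oscillation_def divide_right_mono)
qed

lemma oscillation_pos:
  assumes "0 < t" "\<bar>w\<bar> * t \<le> pi / 2"
  shows "oscillation w t > 0"
proof -
  have "sin (\<bar>w\<bar> * t) > 0" if "w \<noteq> 0"
  proof (rule sin_gt_zero)
    show "0 < \<bar>w\<bar> * t"
      using assms that by simp
    show "\<bar>w\<bar> * t < pi"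
      using assms pi_gt_zero by linarith
  qed
  with assms show ?thesis
    by (subst oscillation_abs) (auto simp: oscillation_def)
qed

text \<open>
  For \<open>w \<noteq> 0\<close> the \<open>T n\<close> are whole periods and equality holds; for \<open>w = 0\<close> the function is the identity,
  so any times tending to infinity will do. The inequality covers both.
\<close>

lemma oscillation_returns:
  obtains T :: "nat \<Rightarrow> real" where "filterlim T at_top sequentially" "\<And>n. T n \<ge> 0"
    "\<And>n t. oscillation w (T n + t) \<ge> oscillation w t"
proof (cases "w = 0")
  case True
  show ?thesis
    by (rule that[of real]) (auto simp: oscillation_def True filterlim_real_sequentially)
next
  case False
  let ?T = "\<lambda>n. 2 * pi / \<bar>w\<bar> * real n"
  show ?thesis
  proof (rule that[of ?T])
    show "filterlim ?T at_top sequentially"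
      using False
      by (intro filterlim_tendsto_pos_mult_at_top[OF tendsto_const] filterlim_real_sequentially) auto
    have "sin (w * (?T n + t)) = sin (w * t)" for n t
    proof -
      have "w * (?T n + t) = w * t + sgn w * (2 * real n * pi)"
        using False by (simp add: field_simps sgn_if)
      with False show ?thesis
        by (auto simp only: sgn_if sin_add sin_diff sin_2npi cos_2npi sin_minus cos_minus
            mult_1 mult_minus1 mult_1_right mult_zero_right mult_zero_left add_0_right minus_zero
            split: if_splits)
    qed
    then show "oscillation w (?T n + t) \<ge> oscillation w t" for n t
      by (simp add: oscillation_def)
  qed auto
qed

text \<open>
  Over \<open>[T + d, T + 2 d]\<close>, with \<open>T\<close> a return time, the integrand rotated by \<open>e^(\<i> Im s T)\<close> has real part
  \<open>e^(- Re s t) S t cos (Im s (t - T))\<close>. The first factor is at least 1, the second at least \<open>S d > 0\<close>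
  and the third at least \<open>1 / 2\<close>, for a \<open>d\<close> that does not depend on \<open>T\<close>. Hence the partial integrals up to
  \<open>T + d\<close> and \<open>T + 2 d\<close> cannot have the same limit.
\<close>

lemma laplace_oscillation_diverges:
  fixes s :: complex
  assumes "Re s \<le> 0"
  shows "\<not> (\<lambda>t. exp (- s * of_real t) * of_real (oscillation w t)) integrable_on {0..}"
    (is "\<not> ?f integrable_on _")
proof
  assume "?f integrable_on {0..}"
  then obtain I where "(?f has_integral I) {0..}"
    by blast
  then have G: "((\<lambda>b. integral {0..b} ?f) \<longlongrightarrow> I) at_top"
    by (rule has_integral_atLeast_iff_tendsto[OF integrable_on_laplace_oscillation, THEN iffD1])
  obtain T where T: "filterlim T at_top sequentially" "\<And>n. T n \<ge> 0"
      "\<And>n t. oscillation w (T n + t) \<ge> oscillation w t"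
    by (rule oscillation_returns[of w]) blast
  \<comment> \<open>Small enough that on \<open>[0, 2 d]\<close> the oscillation still increases and the phase stays below \<open>\<pi> / 3\<close>;
      the summand 1 keeps the denominator positive.\<close>
  define d where "d = 1 / (2 * (\<bar>Im s\<bar> + \<bar>w\<bar> + 1))"
  have d: "d > 0" "\<bar>Im s\<bar> * (2 * d) \<le> 1" "\<bar>w\<bar> * (2 * d) \<le> 1"
    by (auto simp: d_def field_simps)
  have d': "\<bar>Im s\<bar> * (2 * d) \<le> pi / 3" "\<bar>w\<bar> * (2 * d) \<le> pi / 2"
    using d pi_gt3 by linarith+
  have d'': "\<bar>w\<bar> * d \<le> pi / 2"
    using d'(2) mult_left_mono[of d "2 * d" "\<bar>w\<bar>"] d(1) by linarith
  define c where "c = oscillation w d / 2"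
  have "c > 0"
    unfolding c_def using d(1) d'' by (intro half_gt_zero oscillation_pos)
  have lower: "c * d \<le> norm (integral {0..T n + 2 * d} ?f - integral {0..T n + d} ?f)" for n
  proof -
    let ?J = "{T n + d..T n + 2 * d}"
    let ?u = "cis (Im s * T n)"
    have pt: "c \<le> Re (?u * ?f t)" if t: "t \<in> ?J" for t
    proof -
      define r where "r = t - T n"
      have r: "d \<le> r" "r \<le> 2 * d" "t = T n + r"
        using t by (auto simp: r_def)
      have exp_eq: "exp (- s * of_real t) = of_real (exp (- Re s * t)) * cis (- (Im s * t))"
        by (subst exp_eq_polar) simp
      have cis_eq: "?u * cis (- (Im s * t)) = cis (- (Im s * r))"
        by (simp add: cis_mult r(3) algebra_simps)
      have "?u * ?f t =
          of_real (exp (- Re s * t)) * of_real (oscillation w t) * (?u * cis (- (Im s * t)))"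
        unfolding exp_eq by (simp only: mult_ac)
      also have "\<dots> = of_real (exp (- Re s * t) * oscillation w t) * cis (- (Im s * r))"
        unfolding cis_eq by simp
      finally have uf: "?u * ?f t = of_real (exp (- Re s * t) * oscillation w t) * cis (- (Im s * r))" .
      have eq: "Re (?u * ?f t) = exp (- Re s * t) * oscillation w t * cos (Im s * r)"
        unfolding uf by simp
      have "0 \<le> t"
        using r d T(2)[of n] by linarith
      then have e: "1 \<le> exp (- Re s * t)"
        using assms by (simp add: mult_nonpos_nonneg)
      have "\<bar>w\<bar> * r \<le> \<bar>w\<bar> * (2 * d)"
        using r by (intro mult_left_mono) auto
      then have "oscillation w d \<le> oscillation w r"
        using r d d' by (intro oscillation_mono) auto
      also have "\<dots> \<le> oscillation w t"
        using T(3)[of r n] r by simp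
      finally have o: "2 * c \<le> oscillation w t"
        by (simp add: c_def)
      have "\<bar>Im s\<bar> * r \<le> \<bar>Im s\<bar> * (2 * d)"
        using r by (intro mult_left_mono) auto
      then have "cos (pi / 3) \<le> cos (\<bar>Im s\<bar> * r)"
        using r d d' by (intro cos_monotone_0_pi_le) auto
      moreover have "cos (\<bar>Im s\<bar> * r) = cos (Im s * r)"
        by (simp add: abs_if)
      ultimately have "1 / 2 \<le> cos (Im s * r)"
        by (simp add: cos_60)
      with e o \<open>c > 0\<close> have "1 * (2 * c) * (1 / 2) \<le> exp (- Re s * t) * oscillation w t * cos (Im s * r)"
        by (intro mult_mono) auto
      then show ?thesis
        unfolding eq by simp
    qed
    have int: "?f integrable_on ?J"
      by (rule integrable_on_laplace_oscillation)
    have upper: "((\<lambda>t. Re (?u * ?f t)) has_integral Re (?u * integral ?J ?f)) ?J"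
      by (intro has_integral_Re has_integral_mult_right integrable_integral int)
    have "((\<lambda>t. c) has_integral c * d) ?J"
      using has_integral_const_real[of c "T n + d" "T n + 2 * d"] d by (simp add: mult.commute)
    then have "c * d \<le> Re (?u * integral ?J ?f)"
      using upper by (rule has_integral_le) (rule pt)
    also have "\<dots> \<le> norm (integral ?J ?f)"
      using complex_Re_le_cmod[of "?u * integral ?J ?f"] by (simp add: norm_mult)
    also have "integral ?J ?f = integral {0..T n + 2 * d} ?f - integral {0..T n + d} ?f"
    proof -
      have "integral {0..T n + d} ?f + integral ?J ?f = integral {0..T n + 2 * d} ?f"
        using d T(2)[of n]
        by (intro Henstock_Kurzweil_Integration.integral_combine integrable_on_laplace_oscillation) auto
      then show ?thesis
        unfolding eq_diff_eq by (simp only: add.commute)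
    qed
    finally show ?thesis .
  qed
  have shift: "filterlim (\<lambda>n. T n + e) at_top sequentially" for e
    using filterlim_tendsto_add_at_top[OF tendsto_const[of e] T(1)] by (simp add: add.commute)
  have "(\<lambda>n. norm (integral {0..T n + 2 * d} ?f - integral {0..T n + d} ?f)) \<longlonglongrightarrow> norm (I - I)"
    by (intro tendsto_intros filterlim_compose[OF G] shift)
  then have "c * d \<le> norm (I - I)"
    by (rule LIMSEQ_le_const) (use lower in blast)
  with mult_pos_pos[OF \<open>c > 0\<close> d(1)] show False
    by simp
qed

corollary laplace_oscillation_integrable_iff:
  fixes s :: complex
  shows "(\<lambda>t. exp (- s * of_real t) * of_real (oscillation w t)) integrable_on {0..} \<longleftrightarrow> Re s > 0"
proof
  show "Re s > 0" if "(\<lambda>t. exp (- s * of_real t) * of_real (oscillation w t)) integrable_on {0..}"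
    using that laplace_oscillation_diverges[of s w] not_le by blast
  show "(\<lambda>t. exp (- s * of_real t) * of_real (oscillation w t)) integrable_on {0..}" if "Re s > 0"
    using laplace_oscillation[OF that] by (rule has_integral_integrable)
qed

section \<open>The frequency transfer function\<close>

theorem theorem5p3:
  fixes m c k \<omega> :: real and \<alpha> \<beta> lam :: "real \<Rightarrow> real"
  assumes "m > 0" and "c > 0" and "k > 0" and "\<omega> > 0"
    and "1 < \<alpha> \<omega>" and "\<alpha> \<omega> < 3"
    and "0 < \<beta> \<omega>" and "\<beta> \<omega> < 2"
    and "0 \<le> lam \<omega>" and "lam \<omega> < 1"
    and "m_eff m c \<alpha> \<beta> \<omega> > 0"
    and "\<bar>zeta_eff m c k \<alpha> \<beta> lam \<omega>\<bar> \<le> 1"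
  shows "(transfer_converges m c k \<alpha> \<beta> lam \<omega> \<longleftrightarrow> 0 < zeta_eff m c k \<alpha> \<beta> lam \<omega>) \<and>
    (transfer_converges m c k \<alpha> \<beta> lam \<omega> \<longrightarrow>
      freq_transfer m c k \<alpha> \<beta> lam \<omega> =
        1 / (complex_of_real (k_eff k lam \<omega>)
             * (1 - (complex_of_real (gamma_eff m c k \<alpha> \<beta> lam \<omega>))\<^sup>2
                + \<i> * 2 * complex_of_real (zeta_eff m c k \<alpha> \<beta> lam \<omega>)
                    * complex_of_real (gamma_eff m c k \<alpha> \<beta> lam \<omega>))))"
proof -
  define M where "M = m_eff m c \<alpha> \<beta> \<omega>"
  define K where "K = k_eff k lam \<omega>"
  define z where "z = zeta_eff m c k \<alpha> \<beta> lam \<omega>"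
  define n where "n = omega_effn m c k \<alpha> \<beta> lam \<omega>"
  define d where "d = omega_effd m c k \<alpha> \<beta> lam \<omega>"
  define s where "s = Complex (z * n) \<omega>"
  have "M > 0" "\<bar>z\<bar> \<le> 1"
    using assms by (simp_all add: M_def z_def)
  have "lam \<omega> * pi / 2 < pi / 2" "- (pi / 2) < lam \<omega> * pi / 2"
    using assms by (auto intro: less_le_trans[of _ 0])
  then have "cos (lam \<omega> * pi / 2) > 0"
    using cos_gt_zero_pi by blast
  then have "K > 0"
    using assms by (simp add: K_def k_eff_def)
  have n: "n > 0" "n\<^sup>2 = K / M"
    using \<open>M > 0\<close> \<open>K > 0\<close> by (simp_all add: n_def omega_effn_def K_def M_def)
  have "d\<^sup>2 = n\<^sup>2 * (1 - z\<^sup>2)"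
    using \<open>\<bar>z\<bar> \<le> 1\<close>
    by (simp add: d_def omega_effd_def n_def z_def power_mult_distrib abs_square_le_1)
  \<comment> \<open>The square of \<open>Re s = z n\<close> and \<open>d\<^sup>2\<close> add up to \<open>n\<^sup>2\<close>.\<close>
  then have sd: "s\<^sup>2 + (of_real d)\<^sup>2 = of_real (n\<^sup>2 - \<omega>\<^sup>2) + \<i> * 2 * of_real (z * n * \<omega>)"
    by (simp add: complex_eq_iff s_def power2_eq_square algebra_simps)
  have integrand: "transfer_integrand m c k \<alpha> \<beta> lam \<omega> t =
      of_real (1 / M) * (exp (- s * of_real t) * of_real (oscillation d t))" if "t \<ge> 0" for t
  proof -
    have "- s * of_real t = of_real (- z * n * t) + - \<i> * of_real \<omega> * of_real t"
      by (simp add: s_def complex_eq_iff)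
    then have "exp (- s * of_real t) =
        of_real (exp (- z * n * t)) * exp (- \<i> * of_real \<omega> * of_real t)"
      by (simp only: exp_add exp_of_real)
    with that show ?thesis
      by (simp add: transfer_integrand_def impulse_response_def Let_def oscillation_def
          M_def d_def z_def n_def mult_ac)
  qed
  have "transfer_converges m c k \<alpha> \<beta> lam \<omega> \<longleftrightarrow>
      (\<lambda>t. of_real (1 / M) * (exp (- s * of_real t) * of_real (oscillation d t))) integrable_on {0..}"
    unfolding transfer_converges_def by (rule integrable_cong) (simp add: integrand)
  also have "\<dots> \<longleftrightarrow> (\<lambda>t. exp (- s * of_real t) * of_real (oscillation d t)) integrable_on {0..}"
    using \<open>M > 0\<close> by (intro integrable_on_cmult_left_iff) auto
  also have "\<dots> \<longleftrightarrow> Re s > 0"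
    by (rule laplace_oscillation_integrable_iff)
  also have "\<dots> \<longleftrightarrow> 0 < z"
    using n by (simp add: s_def zero_less_mult_iff)
  finally have conv: "transfer_converges m c k \<alpha> \<beta> lam \<omega> \<longleftrightarrow> 0 < z" .
  have "freq_transfer m c k \<alpha> \<beta> lam \<omega> =
      1 / (of_real K * (1 - (of_real (\<omega> / n))\<^sup>2 + \<i> * 2 * of_real z * of_real (\<omega> / n)))" if "0 < z"
  proof -
    have "Re s > 0"
      using that n by (simp add: s_def)
    then have "((\<lambda>t. of_real (1 / M) * (exp (- s * of_real t) * of_real (oscillation d t)))
        has_integral of_real (1 / M) * (1 / (s\<^sup>2 + (of_real d)\<^sup>2))) {0..}"
      by (intro has_integral_mult_right laplace_oscillation)
    then have "(transfer_integrand m c k \<alpha> \<beta> lam \<omega>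
        has_integral of_real (1 / M) * (1 / (s\<^sup>2 + (of_real d)\<^sup>2))) {0..}"
      by (rule has_integral_eq[rotated]) (simp add: integrand)
    then have "freq_transfer m c k \<alpha> \<beta> lam \<omega> = 1 / (of_real M * (s\<^sup>2 + (of_real d)\<^sup>2))"
      unfolding freq_transfer_def by (simp add: integral_unique)
    also have "of_real M * (s\<^sup>2 + (of_real d)\<^sup>2) =
        of_real K * (1 - (of_real (\<omega> / n))\<^sup>2 + \<i> * 2 * of_real z * of_real (\<omega> / n))"
    proof -
      have K: "K = M * n\<^sup>2"
        using n \<open>M > 0\<close> by simp
      have \<omega>: "\<omega> = n * (\<omega> / n)"
        using n(1) by simp
      show ?thesis
        unfolding sd K by (subst (1 2) \<omega>) (simp add: algebra_simps power2_eq_square)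
    qed
    finally show ?thesis .
  qed
  with conv show ?thesis
    by (simp add: K_def z_def n_def gamma_eff_def)
qed

end
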